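(* Let $\mathcal{X}\subseteq\mathbb{R}^d$ and let $(X_t)_{t\ge1}$ be a sequence of i.i.d. $\mathcal{X}$-valued random variables. Suppose $(R_t)_{t=1}^\infty$ is a process in $L^1(\mathbb{P})$ of the form $R_t=f_t(X_1,\dots,X_t)$, for some sequence of permutation-invariant Borel-measurable maps $f_t:\mathcal{X}^t\to\mathbb{R}$. Suppose further that for all $t\ge1$, $$R_{t+1}\le\frac1{t+1}\sum_{i=1}^{t+1}f_t(X_1,\dots,X_{i-1},X_{i+1},\dots,X_{t+1}).$$ Then $(R_t)$ is a reverse submartingale with respect to the exchangeable filtration $(\mathcal{E}_t^X)$. Furthermore, if $R_{t+1}=\frac1{t+1}\sum_{i=1}^{t+1}f_t(X_1,\dots,X_{i-1},X_{i+1},\dots,X_{t+1})$ for all $t\geq 1$, then $(R_t)$ is a reverse martingale with respect to $(\mathcal{E}_t^X)$.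
   Context: $\mathcal{E}^X_t$ is the $\sigma$-algebra generated by all real-valued Borel-measurable functions of $X_1,X_2,\dots$ which are permutation-symmetric in their first $t$ arguments; $(\mathcal{E}^X_t)_{t\ge1}$ is nonincreasing in $t$. A reverse submartingale (resp. reverse martingale) with respect to a nonincreasing sequence of $\sigma$-algebras $(\mathcal{F}_t)$ is an integrable process with $R_t$ $\mathcal{F}_t$-measurable and $\mathbb{E}[R_t\mid\mathcal{F}_{t+1}]\ge R_{t+1}$ (resp. $=R_{t+1}$) a.s. for all $t\ge1$. *)

theory Defs
  imports "HOL-Probability.Probability" "HOL-Combinatorics.Permutations"
begin

text \<open>Sequences are indexed by the positive integers; values at index \<open>0\<close> play no role.
  A tuple in \<open>S\<^sup>t\<close> is an element of \<open>{1..t} \<rightarrow>\<^sub>E S\<close>, an infinite sequence in \<open>S\<close> an element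
  of \<open>{1..} \<rightarrow>\<^sub>E S\<close>. Both sets are closed under precomposition with a permutation of \<open>{1..t}\<close>.\<close>

definition symmetric_in_first :: "nat \<Rightarrow> (nat \<Rightarrow> 'x) set \<Rightarrow> ((nat \<Rightarrow> 'x) \<Rightarrow> real) \<Rightarrow> bool" where
  "symmetric_in_first t D g \<longleftrightarrow>
     (\<forall>\<pi> x. \<pi> permutes {1..t} \<longrightarrow> x \<in> D \<longrightarrow> g (\<lambda>i. x (\<pi> i)) = g x)"

definition exchangeable_filtration ::
    "'a measure \<Rightarrow> 'x measure \<Rightarrow> (nat \<Rightarrow> 'a \<Rightarrow> 'x) \<Rightarrow> nat \<Rightarrow> 'a measure" where
  "exchangeable_filtration M N X t =
     sigma (space M)
       {(\<lambda>\<omega>. g (\<lambda>i\<in>{1..}. X i \<omega>)) -` B \<inter> space M | g B.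
          g \<in> borel_measurable (Pi\<^sub>M {1..} (\<lambda>_. N)) \<and>
          symmetric_in_first t ({1..} \<rightarrow>\<^sub>E space N) g \<and>
          B \<in> sets borel}"

definition reverse_filtration :: "'a measure \<Rightarrow> (nat \<Rightarrow> 'a measure) \<Rightarrow> bool" where
  "reverse_filtration M F \<longleftrightarrow>
     (\<forall>t\<ge>1. subalgebra M (F t)) \<and> (\<forall>t\<ge>1. subalgebra (F t) (F (t + 1)))"

definition reverse_submartingale ::
    "'a measure \<Rightarrow> (nat \<Rightarrow> 'a measure) \<Rightarrow> (nat \<Rightarrow> 'a \<Rightarrow> real) \<Rightarrow> bool" where
  "reverse_submartingale M F R \<longleftrightarrow>
     reverse_filtration M F \<and>
     (\<forall>t\<ge>1. integrable M (R t)) \<and>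
     (\<forall>t\<ge>1. R t \<in> borel_measurable (F t)) \<and>
     (\<forall>t\<ge>1. AE \<omega> in M. real_cond_exp M (F (t + 1)) (R t) \<omega> \<ge> R (t + 1) \<omega>)"

definition reverse_martingale ::
    "'a measure \<Rightarrow> (nat \<Rightarrow> 'a measure) \<Rightarrow> (nat \<Rightarrow> 'a \<Rightarrow> real) \<Rightarrow> bool" where
  "reverse_martingale M F R \<longleftrightarrow>
     reverse_filtration M F \<and>
     (\<forall>t\<ge>1. integrable M (R t)) \<and>
     (\<forall>t\<ge>1. R t \<in> borel_measurable (F t)) \<and>
     (\<forall>t\<ge>1. AE \<omega> in M. real_cond_exp M (F (t + 1)) (R t) \<omega> = R (t + 1) \<omega>)"

text \<open>The \<open>t\<close>-tuple \<open>(x\<^sub>1, \<dots>, x\<^sub>i\<^sub>-\<^sub>1, x\<^sub>i\<^sub>+\<^sub>1, \<dots>, x\<^sub>t\<^sub>+\<^sub>1)\<close>, for \<open>1 \<le> i \<le> t + 1\<close>.\<close>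

definition leave_out :: "nat \<Rightarrow> nat \<Rightarrow> (nat \<Rightarrow> 'x) \<Rightarrow> nat \<Rightarrow> 'x" where
  "leave_out t i x = (\<lambda>j\<in>{1..t}. x (if j < i then j else j + 1))"

end

theory Submission imports Defs begin

text \<open>The law of \<open>(X\<^sub>i)\<^sub>i\<^sub>\<ge>\<^sub>1\<close> is invariant under permutations of the first \<open>t + 1\<close> coordinates, and
  every event of \<open>\<E>\<^sub>t\<^sub>+\<^sub>1\<close> is the preimage of a set of sequences invariant under the same permutations.
  Each leave-one-out term is \<open>f\<^sub>t\<close> evaluated on such a permuted sequence, so all of them, and hence
  their mean, have the conditional expectation of \<open>R\<^sub>t\<close> given \<open>\<E>\<^sub>t\<^sub>+\<^sub>1\<close>. Conditioning the hypothesis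
  on \<open>\<E>\<^sub>t\<^sub>+\<^sub>1\<close>, for which \<open>R\<^sub>t\<^sub>+\<^sub>1\<close> is measurable, gives the claim.\<close>

section \<open>Laws of reindexed i.i.d. families\<close>

text \<open>Independence and the common law \<open>Q\<close> make the law of the family a product
  with all factors equal to \<open>Q\<close>, and reindexing such a product along an injection
  returns the same product.\<close>

lemma (in prob_space) distr_iid_reindex:
  fixes X :: "'i \<Rightarrow> 'a \<Rightarrow> 'b"
  assumes indep: "indep_vars (\<lambda>_. N) X I"
    and ident: "\<And>i. i \<in> I \<Longrightarrow> distr M N (X i) = Q"
    and p: "inj_on p I" "p \<in> I \<rightarrow> I" and "I \<noteq> {}"
  shows "distr M (Pi\<^sub>M I (\<lambda>_. N)) (\<lambda>\<omega>. \<lambda>i\<in>I. X (p i) \<omega>)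
       = distr M (Pi\<^sub>M I (\<lambda>_. N)) (\<lambda>\<omega>. \<lambda>i\<in>I. X i \<omega>)"
proof -
  have rv [measurable]: "i \<in> I \<Longrightarrow> X i \<in> measurable M N" for i
    using indep unfolding indep_vars_def by auto
  obtain j where j: "j \<in> I"
    using \<open>I \<noteq> {}\<close> by auto
  have Q: "prob_space Q"
    unfolding ident[OF j, symmetric] by (rule prob_space_distr) (rule rv[OF j])
  have sets_Q [measurable_cong]: "sets Q = sets N"
    using ident[OF j] by auto
  have PQ: "sets (Pi\<^sub>M I (\<lambda>_. Q)) = sets (Pi\<^sub>M I (\<lambda>_. N))"
    by (intro sets_PiM_cong) (auto simp: sets_Q)
  have law: "distr M (Pi\<^sub>M I (\<lambda>_. N)) (\<lambda>\<omega>. \<lambda>i\<in>I. X i \<omega>) = Pi\<^sub>M I (\<lambda>_. Q)"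
    using indep_vars_iff_distr_eq_PiM'[where M'="\<lambda>_. N" and X=X, OF \<open>I \<noteq> {}\<close> rv] indep
    by (simp add: ident cong: PiM_cong)
  have meas_p: "(\<lambda>x. \<lambda>i\<in>I. x (p i)) \<in> measurable (Pi\<^sub>M I (\<lambda>_. N)) (Pi\<^sub>M I (\<lambda>_. N))"
    using p by (intro measurable_restrict measurable_component_singleton) auto
  have meas_X: "(\<lambda>\<omega>. \<lambda>i\<in>I. X i \<omega>) \<in> measurable M (Pi\<^sub>M I (\<lambda>_. N))"
    by (intro measurable_restrict rv)
  have "distr M (Pi\<^sub>M I (\<lambda>_. N)) (\<lambda>\<omega>. \<lambda>i\<in>I. X (p i) \<omega>)
      = distr (distr M (Pi\<^sub>M I (\<lambda>_. N)) (\<lambda>\<omega>. \<lambda>i\<in>I. X i \<omega>)) (Pi\<^sub>M I (\<lambda>_. N)) (\<lambda>x. \<lambda>i\<in>I. x (p i))"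
    unfolding distr_distr[OF meas_p meas_X]
    using p by (intro distr_cong) (auto simp: o_def restrict_def fun_eq_iff)
  \<comment> \<open>\<open>distr\<close> depends on its target only through space and measurable
    sets, which \<open>N\<close> and \<open>Q\<close> share; writing \<open>Q\<close> on both sides
    gives the form in which \<open>distr_PiM_reindex\<close> applies.\<close>
  also have "\<dots> = distr (Pi\<^sub>M I (\<lambda>_. Q)) (Pi\<^sub>M I (\<lambda>_. Q)) (\<lambda>x. \<lambda>i\<in>I. x (p i))"
    unfolding law by (intro distr_cong) (auto simp: PQ)
  also have "\<dots> = Pi\<^sub>M I (\<lambda>_. Q)"
    using distr_PiM_reindex[of I "\<lambda>_. Q" p I] Q p by simp
  finally show ?thesis
    unfolding law .
qed

section \<open>Structure of the exchangeable sigma-algebras\<close>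

lemma exchangeable_filtration_generator_subset:
  "{(\<lambda>\<omega>. g (\<lambda>i\<in>{1..}. X i \<omega>)) -` B \<inter> space M | g B.
      g \<in> borel_measurable (Pi\<^sub>M {1..} (\<lambda>_. N)) \<and>
      symmetric_in_first t ({1..} \<rightarrow>\<^sub>E space N) g \<and> B \<in> sets borel} \<subseteq> Pow (space M)"
  by auto

lemma space_exchangeable_filtration [simp]: "space (exchangeable_filtration M N X t) = space M"
  unfolding exchangeable_filtration_def
  by (rule space_measure_of[OF exchangeable_filtration_generator_subset])

lemma sets_exchangeable_filtration:
  "sets (exchangeable_filtration M N X t) =
     sigma_sets (space M)
       {(\<lambda>\<omega>. g (\<lambda>i\<in>{1..}. X i \<omega>)) -` B \<inter> space M | g B.
          g \<in> borel_measurable (Pi\<^sub>M {1..} (\<lambda>_. N)) \<and>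
          symmetric_in_first t ({1..} \<rightarrow>\<^sub>E space N) g \<and> B \<in> sets borel}"
  unfolding exchangeable_filtration_def
  by (rule sets_measure_of[OF exchangeable_filtration_generator_subset])

lemma measurable_exchangeable_filtration:
  assumes "g \<in> borel_measurable (Pi\<^sub>M {1..} (\<lambda>_. N))"
    and "symmetric_in_first t ({1..} \<rightarrow>\<^sub>E space N) g"
  shows "(\<lambda>\<omega>. g (\<lambda>i\<in>{1..}. X i \<omega>)) \<in> borel_measurable (exchangeable_filtration M N X t)"
proof (rule measurableI)
  fix B :: "real set"
  assume "B \<in> sets borel"
  then show "(\<lambda>\<omega>. g (\<lambda>i\<in>{1..}. X i \<omega>)) -` B \<inter> space (exchangeable_filtration M N X t)
      \<in> sets (exchangeable_filtration M N X t)"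
    unfolding sets_exchangeable_filtration space_exchangeable_filtration
    using assms by (intro sigma_sets.Basic) blast
qed simp

lemma subalgebra_exchangeable_filtration:
  assumes "\<And>i. i \<ge> 1 \<Longrightarrow> X i \<in> measurable M N"
  shows "subalgebra M (exchangeable_filtration M N X t)"
proof -
  have Y: "(\<lambda>\<omega>. \<lambda>i\<in>{1..}. X i \<omega>) \<in> measurable M (Pi\<^sub>M {1..} (\<lambda>_. N))"
    by (intro measurable_restrict assms) auto
  show ?thesis
    unfolding subalgebra_def sets_exchangeable_filtration space_exchangeable_filtration
    using measurable_sets[OF measurable_compose[OF Y]]
    by (intro conjI refl sets.sigma_sets_subset) blast
qed

text \<open>A permutation of \<open>{1..s}\<close> is also one of \<open>{1..t}\<close>, so symmetry
  in the first \<open>t\<close> arguments is the stronger condition and leaves fewer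
  generators.\<close>

lemma subalgebra_exchangeable_filtration_antimono:
  assumes "s \<le> t"
  shows "subalgebra (exchangeable_filtration M N X s) (exchangeable_filtration M N X t)"
proof -
  have "\<pi> permutes {1..s} \<Longrightarrow> \<pi> permutes {1..t}" for \<pi>
    by (rule permutes_subset) (use assms in auto)
  then have "symmetric_in_first t D g \<Longrightarrow> symmetric_in_first s D g"
    for D and g :: "(nat \<Rightarrow> 'b) \<Rightarrow> real"
    unfolding symmetric_in_first_def by blast
  then show ?thesis
    unfolding subalgebra_def sets_exchangeable_filtration
    by (simp, intro sigma_sets_mono') blast
qed

text \<open>Extended by the identity, \<open>p\<close> permutes \<open>{1..}\<close> and fixes index
  0, so the permuted sequence keeps its default value there and remains extensional.\<close>

lemma permute_in_PiE:
  assumes "p permutes {1..t}" "x \<in> {1..} \<rightarrow>\<^sub>E S"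
  shows "(\<lambda>i. x (p i)) \<in> {1..} \<rightarrow>\<^sub>E S"
proof -
  have "p permutes {1..}"
    by (rule permutes_subset[OF assms(1)]) auto
  then have "p i \<in> {1..} \<longleftrightarrow> i \<in> {1..}" for i
    by (rule permutes_in_image)
  then show ?thesis
    using assms(2) by (auto simp: PiE_def extensional_def Pi_def)
qed

text \<open>The preimages of invariant measurable sets of sequences are closed under complement and
  countable union and include the generators, so induction over \<open>sigma_sets\<close> reaches
  every event. This lets an event follow a permutation of the sequence.\<close>

lemma exchangeable_filtration_setE:
  assumes "A \<in> sets (exchangeable_filtration M N X t)"
    and X: "\<And>i \<omega>. i \<ge> 1 \<Longrightarrow> \<omega> \<in> space M \<Longrightarrow> X i \<omega> \<in> space N"
  obtains C where "C \<in> sets (Pi\<^sub>M {1..} (\<lambda>_. N))"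
    "A = (\<lambda>\<omega>. \<lambda>i\<in>{1..}. X i \<omega>) -` C \<inter> space M"
    "\<And>p x. p permutes {1..t} \<Longrightarrow> x \<in> {1..} \<rightarrow>\<^sub>E space N \<Longrightarrow> (\<lambda>i. x (p i)) \<in> C \<longleftrightarrow> x \<in> C"
proof -
  let ?P = "Pi\<^sub>M {1..} (\<lambda>_. N)" and ?Y = "\<lambda>\<omega>. \<lambda>i\<in>{1..}. X i \<omega>"
  define invariant where "invariant C \<longleftrightarrow> (\<forall>p x. p permutes {1..t} \<longrightarrow> x \<in> {1..} \<rightarrow>\<^sub>E space N \<longrightarrow>
    ((\<lambda>i. x (p i)) \<in> C \<longleftrightarrow> x \<in> C))" for C
  have Y: "?Y \<omega> \<in> space ?P" if "\<omega> \<in> space M" for \<omega>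
    using X that by (auto simp: space_PiM)
  have "\<exists>C\<in>sets ?P. A = ?Y -` C \<inter> space M \<and> invariant C"
    using assms(1) unfolding sets_exchangeable_filtration
  proof (induction rule: sigma_sets.induct)
    case (Basic A)
    then obtain g B where g: "A = (\<lambda>\<omega>. g (?Y \<omega>)) -` B \<inter> space M" "g \<in> borel_measurable ?P"
      "symmetric_in_first t ({1..} \<rightarrow>\<^sub>E space N) g" "B \<in> sets borel"
      by blast
    show ?case
    proof (intro bexI conjI)
      \<comment> \<open>The preimage is cut down to the space of sequences, since \<open>g\<close>
        is measurable only there; by \<open>permute_in_PiE\<close> the cut preserves
        invariance.\<close>
      show "g -` B \<inter> space ?P \<in> sets ?P"
        using g by auto
      show "A = ?Y -` (g -` B \<inter> space ?P) \<inter> space M"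
        using Y by (auto simp: g(1))
      show "invariant (g -` B \<inter> space ?P)"
        using g(3) permute_in_PiE[of _ t _ "space N"]
        unfolding invariant_def symmetric_in_first_def space_PiM by simp
    qed
  next
    case Empty
    show ?case by (intro bexI[of _ "{}"]) (auto simp: invariant_def)
  next
    case (Compl A)
    then obtain C where C: "C \<in> sets ?P" "A = ?Y -` C \<inter> space M" "invariant C"
      by blast
    have "space M - A = ?Y -` (space ?P - C) \<inter> space M"
      using Y by (auto simp: C(2))
    moreover have "invariant (space ?P - C)"
      using C(3) permute_in_PiE[of _ t _ "space N"] unfolding invariant_def space_PiM by simp
    ultimately show ?case
      using C(1) by blast
  next
    case (Union a)
    obtain C where *: "\<forall>n. C n \<in> sets ?P \<and> a n = ?Y -` C n \<inter> space M \<and> invariant (C n)"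
      using choice[OF allI, OF Union.IH[unfolded Bex_def]] by (rule exE)
    note C = *[THEN spec, THEN conjunct1] *[THEN spec, THEN conjunct2, THEN conjunct1]
      *[THEN spec, THEN conjunct2, THEN conjunct2]
    show ?case
    proof (intro bexI conjI)
      show "(\<Union>n. C n) \<in> sets ?P"
        using C(1) by auto
      show "(\<Union>n. a n) = ?Y -` (\<Union>n. C n) \<inter> space M"
        using C(2) by auto
      show "invariant (\<Union>n. C n)"
        using C(3) by (simp add: invariant_def)
    qed
  qed
  then show ?thesis
    using that unfolding invariant_def by blast
qed

section \<open>Expectations and conditional expectations under permutations\<close>

text \<open>Integrability and integral of \<open>h\<close> along a random sequence depend only on
  the law of that sequence, and \<open>distr_iid_reindex\<close> identifies the two laws.\<close>

lemma (in prob_space) iid_permute_integral: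
  fixes h :: "(nat \<Rightarrow> 'b) \<Rightarrow> real"
  assumes indep: "indep_vars (\<lambda>_. N) X {1..}"
    and ident: "\<And>i. i \<ge> 1 \<Longrightarrow> distr M N (X i) = Q"
    and h: "h \<in> borel_measurable (Pi\<^sub>M {1..} (\<lambda>_. N))"
    and p: "p permutes {1..t}"
  shows "integrable M (\<lambda>\<omega>. h (\<lambda>i\<in>{1..}. X (p i) \<omega>)) \<longleftrightarrow> integrable M (\<lambda>\<omega>. h (\<lambda>i\<in>{1..}. X i \<omega>))"
    and "(\<integral>\<omega>. h (\<lambda>i\<in>{1..}. X (p i) \<omega>) \<partial>M) = (\<integral>\<omega>. h (\<lambda>i\<in>{1..}. X i \<omega>) \<partial>M)"
proof -
  have p': "p permutes {1..}"
    by (rule permutes_subset[OF p]) auto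
  have pi: "p i \<in> {1..}" if "i \<in> {1..}" for i
    using permutes_in_image[OF p'] that by blast
  have X: "X i \<in> measurable M N" if "i \<in> {1..}" for i
    using indep that unfolding indep_vars_def by auto
  have Y: "(\<lambda>\<omega>. \<lambda>i\<in>{1..}. X i \<omega>) \<in> measurable M (Pi\<^sub>M {1..} (\<lambda>_. N))"
    by (intro measurable_restrict X)
  have Yp: "(\<lambda>\<omega>. \<lambda>i\<in>{1..}. X (p i) \<omega>) \<in> measurable M (Pi\<^sub>M {1..} (\<lambda>_. N))"
    by (intro measurable_restrict X pi)
  have eq: "distr M (Pi\<^sub>M {1..} (\<lambda>_. N)) (\<lambda>\<omega>. \<lambda>i\<in>{1..}. X (p i) \<omega>)
      = distr M (Pi\<^sub>M {1..} (\<lambda>_. N)) (\<lambda>\<omega>. \<lambda>i\<in>{1..}. X i \<omega>)"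
    using distr_iid_reindex[OF indep, of Q p] ident pi permutes_inj_on[OF p'] by auto
  show "integrable M (\<lambda>\<omega>. h (\<lambda>i\<in>{1..}. X (p i) \<omega>)) \<longleftrightarrow> integrable M (\<lambda>\<omega>. h (\<lambda>i\<in>{1..}. X i \<omega>))"
    unfolding integrable_distr_eq[OF Yp h, symmetric] integrable_distr_eq[OF Y h, symmetric] eq ..
  show "(\<integral>\<omega>. h (\<lambda>i\<in>{1..}. X (p i) \<omega>) \<partial>M) = (\<integral>\<omega>. h (\<lambda>i\<in>{1..}. X i \<omega>) \<partial>M)"
    unfolding integral_distr[OF Yp h, symmetric] integral_distr[OF Y h, symmetric] eq ..
qed

text \<open>It suffices to compare integrals over an event \<open>A\<close> of the sigma-algebra.
  Such an \<open>A\<close> is the preimage of an invariant \<open>C\<close>, so the indicator of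
  \<open>A\<close> can be absorbed into the integrand as a function of the permuted sequence, and
  invariance of the law then removes the permutation.\<close>

lemma (in prob_space) cond_exp_exchangeable_permute:
  fixes h :: "(nat \<Rightarrow> 'b) \<Rightarrow> real"
  assumes indep: "indep_vars (\<lambda>_. N) X {1..}"
    and ident: "\<And>i. i \<ge> 1 \<Longrightarrow> distr M N (X i) = Q"
    and h: "h \<in> borel_measurable (Pi\<^sub>M {1..} (\<lambda>_. N))"
    and int: "integrable M (\<lambda>\<omega>. h (\<lambda>i\<in>{1..}. X i \<omega>))"
    and p: "p permutes {1..t}"
  shows "AE \<omega> in M. real_cond_exp M (exchangeable_filtration M N X t) (\<lambda>\<omega>. h (\<lambda>i\<in>{1..}. X (p i) \<omega>)) \<omega>
      = real_cond_exp M (exchangeable_filtration M N X t) (\<lambda>\<omega>. h (\<lambda>i\<in>{1..}. X i \<omega>)) \<omega>"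
proof -
  let ?P = "Pi\<^sub>M {1..} (\<lambda>_. N)" and ?F = "exchangeable_filtration M N X t"
  have X: "X i \<in> measurable M N" if "i \<ge> 1" for i
    using indep that unfolding indep_vars_def by auto
  interpret F: finite_measure_subalgebra M ?F
    by unfold_locales (rule subalgebra_exchangeable_filtration[OF X])
  show ?thesis
  proof (rule F.real_cond_exp_charact)
    fix A
    assume A: "A \<in> sets ?F"
    then obtain C where C: "C \<in> sets ?P" "A = (\<lambda>\<omega>. \<lambda>i\<in>{1..}. X i \<omega>) -` C \<inter> space M"
      "\<And>p x. p permutes {1..t} \<Longrightarrow> x \<in> {1..} \<rightarrow>\<^sub>E space N \<Longrightarrow> (\<lambda>i. x (p i)) \<in> C \<longleftrightarrow> x \<in> C"
      using measurable_space[OF X] by (elim exchangeable_filtration_setE) auto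
    have meas: "(\<lambda>x. indicator C x * h x) \<in> borel_measurable ?P"
      using C(1) h by measurable
    have "(\<integral>\<omega>\<in>A. h (\<lambda>i\<in>{1..}. X (p i) \<omega>) \<partial>M)
        = (\<integral>\<omega>. indicator C (\<lambda>i\<in>{1..}. X (p i) \<omega>) * h (\<lambda>i\<in>{1..}. X (p i) \<omega>) \<partial>M)"
      unfolding set_lebesgue_integral_def
    proof (intro Bochner_Integration.integral_cong refl)
      fix \<omega>
      assume \<omega>: "\<omega> \<in> space M"
      have "p permutes {1..}"
        by (rule permutes_subset[OF p]) auto
      \<comment> \<open>Since \<open>p\<close> preserves \<open>{1..}\<close>, permuting commutes
        with restricting to \<open>{1..}\<close>; this puts the sequence in the form to which
        invariance of \<open>C\<close> applies.\<close>
      then have "p i \<in> {1..} \<longleftrightarrow> i \<in> {1..}" for i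
        by (rule permutes_in_image)
      then have "(\<lambda>i\<in>{1..}. X (p i) \<omega>) = (\<lambda>i. (\<lambda>i\<in>{1..}. X i \<omega>) (p i))"
        by (auto simp: restrict_def fun_eq_iff)
      moreover have "(\<lambda>i\<in>{1..}. X i \<omega>) \<in> {1..} \<rightarrow>\<^sub>E space N"
        using measurable_space[OF X] \<omega> by auto
      ultimately have "(\<lambda>i\<in>{1..}. X (p i) \<omega>) \<in> C \<longleftrightarrow> (\<lambda>i\<in>{1..}. X i \<omega>) \<in> C"
        using C(3)[OF p] by metis
      then show "indicator A \<omega> *\<^sub>R h (\<lambda>i\<in>{1..}. X (p i) \<omega>)
          = indicator C (\<lambda>i\<in>{1..}. X (p i) \<omega>) * h (\<lambda>i\<in>{1..}. X (p i) \<omega>)"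
        using \<omega> by (simp add: C(2) indicator_def)
    qed
    also have "\<dots> = (\<integral>\<omega>. indicator C (\<lambda>i\<in>{1..}. X i \<omega>) * h (\<lambda>i\<in>{1..}. X i \<omega>) \<partial>M)"
      by (rule iid_permute_integral(2)[OF indep ident meas p])
    also have "\<dots> = (\<integral>\<omega>\<in>A. h (\<lambda>i\<in>{1..}. X i \<omega>) \<partial>M)"
      unfolding set_lebesgue_integral_def
      by (intro Bochner_Integration.integral_cong) (auto simp: C(2) indicator_def)
    also have "\<dots> = (\<integral>\<omega>\<in>A. real_cond_exp M ?F (\<lambda>\<omega>. h (\<lambda>i\<in>{1..}. X i \<omega>)) \<omega> \<partial>M)"
      by (rule F.real_cond_exp_intA[OF int A])
    finally show "(\<integral>\<omega>\<in>A. h (\<lambda>i\<in>{1..}. X (p i) \<omega>) \<partial>M)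
        = (\<integral>\<omega>\<in>A. real_cond_exp M ?F (\<lambda>\<omega>. h (\<lambda>i\<in>{1..}. X i \<omega>)) \<omega> \<partial>M)" .
  next
    show "integrable M (\<lambda>\<omega>. h (\<lambda>i\<in>{1..}. X (p i) \<omega>))"
      using iid_permute_integral(1)[OF indep ident h p] int by simp
  qed (intro F.real_cond_exp_int(1)[OF int] borel_measurable_cond_exp)+
qed

section \<open>Leave-one-out means\<close>

text \<open>The omitted index \<open>i\<close> is sent to the extra position \<open>t + 1\<close>,
  which the tuple never reads; this completes the shift to a permutation.\<close>

lemma leave_out_permutation:
  assumes "1 \<le> i" "i \<le> t + 1"
  obtains p where "p permutes {1..t + 1}" "\<And>x. leave_out t i x = (\<lambda>j\<in>{1..t}. x (p j))"
proof
  \<comment> \<open>This is the cycle \<open>i\<close>, \<open>i + 1\<close>, ...,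
    \<open>t + 1\<close> and back to \<open>i\<close>, with all other indices fixed. Being injective
    on a finite set that it maps into itself, it is bijective there.\<close>
  let ?p = "\<lambda>j. if j \<in> {1..t} then (if j < i then j else j + 1) else if j = t + 1 then i else j"
  have inj: "inj_on ?p {1..t + 1}"
    by (auto simp: inj_on_def split: if_splits)
  moreover have "?p ` {1..t + 1} \<subseteq> {1..t + 1}"
    using assms by (auto split: if_splits)
  ultimately have "bij_betw ?p {1..t + 1} {1..t + 1}"
    using endo_inj_surj[of "{1..t + 1}" ?p] by (simp add: bij_betw_def)
  then show "?p permutes {1..t + 1}"
    by (rule bij_imp_permutes) auto
  show "leave_out t i x = (\<lambda>j\<in>{1..t}. x (?p j))" for x :: "nat \<Rightarrow> 'b"
    by (auto simp: leave_out_def restrict_def fun_eq_iff)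
qed

text \<open>By linearity: all \<open>t + 1\<close> summands have the same conditional expectation,
  and the factor in front cancels their number. The permutations involved move index
  \<open>t + 1\<close>, which is why the conditioning is at level \<open>t + 1\<close>.\<close>

lemma (in prob_space) cond_exp_exchangeable_leave_out_mean:
  fixes f :: "(nat \<Rightarrow> 'b) \<Rightarrow> real"
  assumes indep: "indep_vars (\<lambda>_. N) X {1..}"
    and ident: "\<And>i. i \<ge> 1 \<Longrightarrow> distr M N (X i) = Q"
    and f: "f \<in> borel_measurable (Pi\<^sub>M {1..t} (\<lambda>_. N))"
    and int: "integrable M (\<lambda>\<omega>. f (\<lambda>i\<in>{1..t}. X i \<omega>))"
  defines "U \<equiv> \<lambda>\<omega>. 1 / real (t + 1) * (\<Sum>i=1..t + 1. f (leave_out t i (\<lambda>j. X j \<omega>)))"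
  shows "integrable M U"
    and "AE \<omega> in M. real_cond_exp M (exchangeable_filtration M N X (t + 1)) U \<omega>
      = real_cond_exp M (exchangeable_filtration M N X (t + 1)) (\<lambda>\<omega>. f (\<lambda>i\<in>{1..t}. X i \<omega>)) \<omega>"
proof -
  let ?F = "exchangeable_filtration M N X (t + 1)" and ?R = "\<lambda>\<omega>. f (\<lambda>i\<in>{1..t}. X i \<omega>)"
  let ?V = "\<lambda>i \<omega>. f (leave_out t i (\<lambda>j. X j \<omega>))"
  \<comment> \<open>\<open>h\<close> lifts \<open>f\<close> to whole sequences by truncation, so
    that the permutation lemmas for sequences apply.\<close>
  define h where "h x = f (restrict x {1..t})" for x
  have h: "h \<in> borel_measurable (Pi\<^sub>M {1..} (\<lambda>_. N))"
    unfolding h_def by (rule measurable_compose[OF measurable_restrict_subset f]) auto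
  have hX: "h (\<lambda>i\<in>{1..}. X (p i) \<omega>) = f (\<lambda>i\<in>{1..t}. X (p i) \<omega>)" for p \<omega>
    unfolding h_def by (rule arg_cong[of _ _ f]) (auto simp: restrict_def fun_eq_iff)
  note hX_id = hX[of "\<lambda>i. i"]
  have V: "integrable M (?V i)" "AE \<omega> in M. real_cond_exp M ?F (?V i) \<omega> = real_cond_exp M ?F ?R \<omega>"
    if "i \<in> {1..t + 1}" for i
  proof -
    obtain p where p: "p permutes {1..t + 1}" "\<And>x :: nat \<Rightarrow> 'b. leave_out t i x = (\<lambda>j\<in>{1..t}. x (p j))"
      using leave_out_permutation[of i t] \<open>i \<in> {1..t + 1}\<close> by auto
    show "integrable M (?V i)"
      using iid_permute_integral(1)[OF indep ident h p(1)] int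
      unfolding p(2) hX hX_id by simp
    show "AE \<omega> in M. real_cond_exp M ?F (?V i) \<omega> = real_cond_exp M ?F ?R \<omega>"
      using cond_exp_exchangeable_permute[OF indep ident h _ p(1)] int
      unfolding p(2) hX hX_id by simp
  qed
  have X: "X i \<in> measurable M N" if "i \<ge> 1" for i
    using indep that unfolding indep_vars_def by auto
  interpret F: finite_measure_subalgebra M ?F
    by unfold_locales (rule subalgebra_exchangeable_filtration[OF X])
  show "integrable M U"
    unfolding U_def by (intro Bochner_Integration.integrable_mult_right Bochner_Integration.integrable_sum V(1))
  \<comment> \<open>\<open>real_cond_exp_sum\<close> asks for integrability at every index, whereas
    \<open>V(1)\<close> covers only \<open>{1..t + 1}\<close>; the family is therefore set to zero
    outside \<open>I\<close>.\<close>
  have sum: "AE \<omega> in M. real_cond_exp M ?F (\<lambda>\<omega>. \<Sum>i\<in>I. ?V i \<omega>) \<omega> = (\<Sum>i\<in>I. real_cond_exp M ?F (?V i) \<omega>)"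
    if "I \<subseteq> {1..t + 1}" for I
    using F.real_cond_exp_sum[of "\<lambda>i. if i \<in> I then ?V i else (\<lambda>_. 0)" I] V(1) that
    by (auto simp: subset_eq cong: sum.cong)
  have "AE \<omega> in M. \<forall>i\<in>{1..t + 1}. real_cond_exp M ?F (?V i) \<omega> = real_cond_exp M ?F ?R \<omega>"
    using V(2) by (intro AE_finite_allI) auto
  moreover have "AE \<omega> in M. real_cond_exp M ?F (\<lambda>\<omega>. \<Sum>i=1..t + 1. ?V i \<omega>) \<omega>
      = (\<Sum>i=1..t + 1. real_cond_exp M ?F (?V i) \<omega>)"
    by (rule sum) simp
  moreover have "AE \<omega> in M. real_cond_exp M ?F U \<omega>
      = 1 / real (t + 1) * real_cond_exp M ?F (\<lambda>\<omega>. \<Sum>i=1..t + 1. ?V i \<omega>) \<omega>"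
    unfolding U_def by (intro F.real_cond_exp_cmult Bochner_Integration.integrable_sum V(1))
  ultimately show "AE \<omega> in M. real_cond_exp M ?F U \<omega> = real_cond_exp M ?F ?R \<omega>"
    by eventually_elim simp
qed

text \<open>The generators are functions of the whole sequence, so \<open>f\<close> is lifted by
  truncation. A permutation of \<open>{1..t}\<close> commutes with truncation to
  \<open>{1..t}\<close>, so the lift inherits the symmetry.\<close>

lemma measurable_exchangeable_filtration_statistic:
  assumes f: "f \<in> borel_measurable (Pi\<^sub>M {1..t} (\<lambda>_. N))"
    and sym: "symmetric_in_first t ({1..t} \<rightarrow>\<^sub>E space N) f"
  shows "(\<lambda>\<omega>. f (\<lambda>i\<in>{1..t}. X i \<omega>)) \<in> borel_measurable (exchangeable_filtration M N X t)"
proof -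
  define h where "h x = f (restrict x {1..t})" for x
  have "h \<in> borel_measurable (Pi\<^sub>M {1..} (\<lambda>_. N))"
    unfolding h_def by (rule measurable_compose[OF measurable_restrict_subset f]) auto
  moreover have "symmetric_in_first t ({1..} \<rightarrow>\<^sub>E space N) h"
    unfolding symmetric_in_first_def
  proof (intro allI impI)
    fix p and x :: "nat \<Rightarrow> 'a"
    assume p: "p permutes {1..t}" and x: "x \<in> {1..} \<rightarrow>\<^sub>E space N"
    have "restrict (\<lambda>i. x (p i)) {1..t} = (\<lambda>i. restrict x {1..t} (p i))"
      using permutes_in_image[OF p] by (auto simp: restrict_def fun_eq_iff)
    moreover have "restrict x {1..t} \<in> {1..t} \<rightarrow>\<^sub>E space N"
      using x by (auto simp: PiE_def Pi_def)
    ultimately show "h (\<lambda>i. x (p i)) = h x"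
      using sym p unfolding h_def symmetric_in_first_def by metis
  qed
  ultimately have "(\<lambda>\<omega>. h (\<lambda>i\<in>{1..}. X i \<omega>)) \<in> borel_measurable (exchangeable_filtration M N X t)"
    by (rule measurable_exchangeable_filtration)
  moreover have "h (\<lambda>i\<in>{1..}. X i \<omega>) = f (\<lambda>i\<in>{1..t}. X i \<omega>)" for \<omega>
    unfolding h_def by (rule arg_cong[of _ _ f]) (auto simp: restrict_def fun_eq_iff)
  ultimately show ?thesis
    by simp
qed

section \<open>The reverse submartingale and martingale properties\<close>

theorem proposition2:
  fixes M :: "'a measure"
    and S :: "(real ^ 'd) set"
    and X :: "nat \<Rightarrow> 'a \<Rightarrow> real ^ 'd"
    and R :: "nat \<Rightarrow> 'a \<Rightarrow> real"
    and f :: "nat \<Rightarrow> (nat \<Rightarrow> real ^ 'd) \<Rightarrow> real"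
  assumes "prob_space M"
    and "prob_space.indep_vars M (\<lambda>_. restrict_space borel S) X {1..}"
    and "\<And>t. t \<ge> 1 \<Longrightarrow>
           distr M (restrict_space borel S) (X t) = distr M (restrict_space borel S) (X 1)"
    and "\<And>t. t \<ge> 1 \<Longrightarrow> f t \<in> borel_measurable (Pi\<^sub>M {1..t} (\<lambda>_. restrict_space borel S))"
    and "\<And>t. t \<ge> 1 \<Longrightarrow> symmetric_in_first t ({1..t} \<rightarrow>\<^sub>E S) (f t)"
    and "\<And>t \<omega>. t \<ge> 1 \<Longrightarrow> \<omega> \<in> space M \<Longrightarrow> R t \<omega> = f t (\<lambda>i\<in>{1..t}. X i \<omega>)"
    and "\<And>t. t \<ge> 1 \<Longrightarrow> integrable M (R t)"
    and "\<And>t. t \<ge> 1 \<Longrightarrow> AE \<omega> in M.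
           R (t + 1) \<omega> \<le> 1 / real (t + 1) * (\<Sum>i=1..t + 1. f t (leave_out t i (\<lambda>j. X j \<omega>)))"
  shows "reverse_submartingale M (exchangeable_filtration M (restrict_space borel S) X) R
    \<and> ((\<forall>t\<ge>1. AE \<omega> in M.
           R (t + 1) \<omega> = 1 / real (t + 1) * (\<Sum>i=1..t + 1. f t (leave_out t i (\<lambda>j. X j \<omega>))))
        \<longrightarrow> reverse_martingale M (exchangeable_filtration M (restrict_space borel S) X) R)"
proof -
  interpret prob_space M by (rule assms(1))
  let ?N = "restrict_space borel S :: (real ^ 'd) measure"
  let ?F = "exchangeable_filtration M ?N X"
  define U where
    "U t \<omega> = 1 / real (t + 1) * (\<Sum>i=1..t + 1. f t (leave_out t i (\<lambda>j. X j \<omega>)))" for t \<omega>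
  have X: "X i \<in> measurable M ?N" if "i \<ge> 1" for i
    using assms(2) that unfolding indep_vars_def by auto
  have sub: "subalgebra M (?F t)" for t
    by (rule subalgebra_exchangeable_filtration[OF X])
  have filt: "reverse_filtration M ?F"
    unfolding reverse_filtration_def
    by (intro conjI allI impI sub subalgebra_exchangeable_filtration_antimono) simp
  have meas: "R t \<in> borel_measurable (?F t)" if "t \<ge> 1" for t
  proof -
    have "(\<lambda>\<omega>. f t (\<lambda>i\<in>{1..t}. X i \<omega>)) \<in> borel_measurable (?F t)"
      using assms(4,5)[OF that] by (intro measurable_exchangeable_filtration_statistic) (auto simp: space_restrict_space)
    \<comment> \<open>\<open>R t\<close> is tied to \<open>f t\<close> only on
      \<open>space M\<close>, so measurability is transferred by congruence on that space.\<close>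
    moreover have "R t \<in> borel_measurable (?F t) \<longleftrightarrow>
        (\<lambda>\<omega>. f t (\<lambda>i\<in>{1..t}. X i \<omega>)) \<in> borel_measurable (?F t)"
      by (rule measurable_cong) (simp only: space_exchangeable_filtration assms(6)[OF that])
    ultimately show ?thesis
      by blast
  qed
  have cond: "integrable M (U t) \<and> (AE \<omega> in M. real_cond_exp M (?F (t + 1)) (U t) \<omega>
      = real_cond_exp M (?F (t + 1)) (R t) \<omega>)" if "t \<ge> 1" for t
  proof -
    interpret F: finite_measure_subalgebra M "?F (t + 1)"
      by unfold_locales (rule sub)
    have int: "integrable M (\<lambda>\<omega>. f t (\<lambda>i\<in>{1..t}. X i \<omega>))"
      using assms(7)[OF that] assms(6)[OF that] by (simp cong: Bochner_Integration.integrable_cong)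
    have U: "integrable M (U t)" "AE \<omega> in M. real_cond_exp M (?F (t + 1)) (U t) \<omega>
        = real_cond_exp M (?F (t + 1)) (\<lambda>\<omega>. f t (\<lambda>i\<in>{1..t}. X i \<omega>)) \<omega>"
      unfolding U_def[abs_def]
      by (rule cond_exp_exchangeable_leave_out_mean[OF assms(2,3) assms(4)[OF that] int], assumption)+
    have "AE \<omega> in M. real_cond_exp M (?F (t + 1)) (\<lambda>\<omega>. f t (\<lambda>i\<in>{1..t}. X i \<omega>)) \<omega>
        = real_cond_exp M (?F (t + 1)) (R t) \<omega>"
      using assms(6)[OF that] int assms(7)[OF that] by (intro F.real_cond_exp_cong) auto
    with U(2) have "AE \<omega> in M. real_cond_exp M (?F (t + 1)) (U t) \<omega> = real_cond_exp M (?F (t + 1)) (R t) \<omega>"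
      by eventually_elim (rule trans)
    with U(1) show ?thesis
      by blast
  qed
  \<comment> \<open>Conditioning leaves \<open>R (t + 1)\<close> unchanged almost surely because it
    is integrable and measurable at level \<open>t + 1\<close>.\<close>
  have R_cond: "AE \<omega> in M. real_cond_exp M (?F (t + 1)) (R (t + 1)) \<omega> = R (t + 1) \<omega>" for t
  proof -
    interpret F: finite_measure_subalgebra M "?F (t + 1)"
      by unfold_locales (rule sub)
    show ?thesis
      by (intro F.real_cond_exp_F_meas assms(7) meas) auto
  qed
  have "AE \<omega> in M. real_cond_exp M (?F (t + 1)) (R t) \<omega> \<ge> R (t + 1) \<omega>" if "t \<ge> 1" for t
  proof -
    interpret F: finite_measure_subalgebra M "?F (t + 1)"
      by unfold_locales (rule sub)
    \<comment> \<open>The assumed bound by \<open>U t\<close> is conditioned by monotonicity. The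
      left side is \<open>R (t + 1)\<close> by \<open>R_cond\<close>, the right side is the
      conditional expectation of \<open>R t\<close> by \<open>cond\<close>.\<close>
    have "AE \<omega> in M. real_cond_exp M (?F (t + 1)) (R (t + 1)) \<omega> \<le> real_cond_exp M (?F (t + 1)) (U t) \<omega>"
      using assms(7,8) cond that by (intro F.real_cond_exp_mono) (auto simp: U_def)
    with R_cond[of t] conjunct2[OF cond[OF that]] show ?thesis
      by eventually_elim simp
  qed
  moreover have "AE \<omega> in M. real_cond_exp M (?F (t + 1)) (R t) \<omega> = R (t + 1) \<omega>"
    if "t \<ge> 1" "AE \<omega> in M. R (t + 1) \<omega> = U t \<omega>" for t
  proof -
    interpret F: finite_measure_subalgebra M "?F (t + 1)"
      by unfold_locales (rule sub)
    \<comment> \<open>The same chain, with congruence of conditional expectations under almost sure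
      equality in place of monotonicity.\<close>
    have "AE \<omega> in M. real_cond_exp M (?F (t + 1)) (R (t + 1)) \<omega> = real_cond_exp M (?F (t + 1)) (U t) \<omega>"
      using that assms(7)[of "t + 1"] cond[OF that(1)] by (intro F.real_cond_exp_cong) auto
    with R_cond[of t] conjunct2[OF cond[OF that(1)]] show ?thesis
      by eventually_elim simp
  qed
  ultimately show ?thesis
    using filt meas assms(7)
    unfolding reverse_submartingale_def reverse_martingale_def U_def by blast
qed

end
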